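(* Let $(\mu_k)_{k\ge 0}\subset(0,1)$ be an interpolating sequence for $H^2(\mathbb{D})$, and let $\nu=\sum_{k\ge 0}(1-\mu_k^2)\,\delta_{\mu_k}$, a measure on $[0,1)$. Assume that $\{t^\ell\}_{\ell\in\mathbb{N}}$ is a frame for $L^2(\nu)$, and let $(\lambda_n)_{n\ge 0}\subset(0,\infty)$. If the family $\{t^{\lambda_n}\}_{n\ge 0}$ is a frame for $L^2(\nu)$, then both of the following conditions hold: (1) $\sum_{n\ge 0}\frac{1}{\lambda_n}=\infty$; (2) $0<\inf_{k\ge 0}(1-\mu_k^2)\sum_{n\ge 0}\mu_k^{2\lambda_n}\le\sup_{k\ge 0}(1-\mu_k^2)\sum_{n\ge 0}\mu_k^{2\lambda_n}<\infty$.
   Context: $\mathbb{D}$ is the open unit disc. A sequence $(z_k)_{k\ge 0}$ in $\mathbb{D}$ is interpolating if there is $\delta>0$ such that $\prod_{j\ne k}\left|\frac{z_k-z_j}{1-\overline{z_j}z_k}\right|\ge\delta$ for all $k\ge 0$ (Carleson's condition; in particular the points are distinct). $\delta_x$ denotes the Dirac measure at $x$; $t^\lambda$ denotes the function $t\mapsto t^\lambda$ in $L^2(\nu)$; $\mathbb{N}=\{0,1,2,\dots\}$. A family $(x_n)$ in a Hilbert space $H$ is a frame for $H$ if there are constants $A,B>0$ with $A\|x\|^2\le\sum_n|\langle x,x_n\rangle|^2\le B\|x\|^2$ for all $x\in H$. *)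

theory Defs
  imports "HOL-Probability.Probability"
begin

definition interpolating :: "(nat \<Rightarrow> complex) \<Rightarrow> bool" where
  "interpolating z \<longleftrightarrow>
     (\<forall>k. norm (z k) < 1) \<and>
     (\<exists>\<delta>>0. \<forall>k.
        let b = (\<lambda>j. if j = k then 1 else norm ((z k - z j) / (1 - cnj (z j) * z k)))
        in convergent_prod b \<and> \<delta> \<le> prodinf b)"

text \<open>
  In the library, a product whose partial products tend to 0 without any factor being 0 is
  divergent and its \<^const>\<open>prodinf\<close> is unspecified. Hence convergence is demanded explicitly
  above; such a product has value 0 and violates the lower bound anyway.
\<close>

text \<open>
  Elements of the complex Hilbert space of square-integrable functions are represented by
  functions rather than by classes modulo equality almost everywhere; the integrals below do not
  depend on the choice of representative.
\<close>

definition L2_space :: "'a measure \<Rightarrow> ('a \<Rightarrow> complex) set" where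
  "L2_space M = {f \<in> borel_measurable M. integrable M (\<lambda>x. (norm (f x))\<^sup>2)}"

definition L2_inner :: "'a measure \<Rightarrow> ('a \<Rightarrow> complex) \<Rightarrow> ('a \<Rightarrow> complex) \<Rightarrow> complex" where
  "L2_inner M f g = (\<integral>x. f x * cnj (g x) \<partial>M)"

definition L2_norm :: "'a measure \<Rightarrow> ('a \<Rightarrow> complex) \<Rightarrow> real" where
  "L2_norm M f = sqrt (\<integral>x. (norm (f x))\<^sup>2 \<partial>M)"

definition L2_frame :: "'a measure \<Rightarrow> (nat \<Rightarrow> 'a \<Rightarrow> complex) \<Rightarrow> bool" where
  "L2_frame M x \<longleftrightarrow>
     (\<forall>n. x n \<in> L2_space M) \<and>
     (\<exists>A>0. \<exists>B>0. \<forall>f\<in>L2_space M.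
        ennreal (A * (L2_norm M f)\<^sup>2) \<le> (\<Sum>n. ennreal ((norm (L2_inner M f (x n)))\<^sup>2)) \<and>
        (\<Sum>n. ennreal ((norm (L2_inner M f (x n)))\<^sup>2)) \<le> ennreal (B * (L2_norm M f)\<^sup>2))"

abbreviation borel01 :: "real measure" where
  "borel01 \<equiv> restrict_space borel {0..<1}"

definition point_mass_measure :: "(nat \<Rightarrow> real) \<Rightarrow> real measure" where
  "point_mass_measure \<mu> =
     measure_of {0..<1} (sets borel01)
       (\<lambda>A. \<Sum>k. ennreal (1 - (\<mu> k)\<^sup>2) * emeasure (return borel01 (\<mu> k)) A)"

lemma sets_borel01_subset: "sets borel01 \<subseteq> Pow {0..<1}"
  using sets.space_closed[of borel01] by (simp add: space_restrict_space)

lemma space_point_mass_measure [simp]: "space (point_mass_measure \<mu>) = {0..<1}"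
  unfolding point_mass_measure_def by (rule space_measure_of[OF sets_borel01_subset])

lemma sets_point_mass_measure [simp, measurable_cong]:
  "sets (point_mass_measure \<mu>) = sets borel01"
proof -
  have "sigma_sets {0..<1} (sets borel01) = sets borel01"
    using sets.sigma_sets_eq[of borel01] by (simp add: space_restrict_space)
  then show ?thesis
    unfolding point_mass_measure_def sets_measure_of[OF sets_borel01_subset] .
qed

lemma emeasure_point_mass_measure:
  assumes "A \<in> sets borel01"
  shows "emeasure (point_mass_measure \<mu>) A =
           (\<Sum>k. ennreal (1 - (\<mu> k)\<^sup>2) * emeasure (return borel01 (\<mu> k)) A)"
proof (rule emeasure_measure_of[OF point_mass_measure_def])
  show "sets borel01 \<subseteq> Pow {0..<1}" by (rule sets_borel01_subset)
  show "A \<in> sets (point_mass_measure \<mu>)" using assms by simp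
  show "positive (sets (point_mass_measure \<mu>))
          (\<lambda>A. \<Sum>k. ennreal (1 - (\<mu> k)\<^sup>2) * emeasure (return borel01 (\<mu> k)) A)"
    by (simp add: positive_def)
  show "countably_additive (sets (point_mass_measure \<mu>))
          (\<lambda>A. \<Sum>k. ennreal (1 - (\<mu> k)\<^sup>2) * emeasure (return borel01 (\<mu> k)) A)"
    unfolding countably_additive_def
  proof (intro allI impI)
    fix F :: "nat \<Rightarrow> real set"
    assume F: "range F \<subseteq> sets (point_mass_measure \<mu>)" "disjoint_family F"
    have "(\<Sum>i k. ennreal (1 - (\<mu> k)\<^sup>2) * emeasure (return borel01 (\<mu> k)) (F i))
        = (\<Sum>k i. ennreal (1 - (\<mu> k)\<^sup>2) * emeasure (return borel01 (\<mu> k)) (F i))"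
      using nn_integral_suminf[of "\<lambda>i k. ennreal (1 - (\<mu> k)\<^sup>2) * emeasure (return borel01 (\<mu> k)) (F i)" "count_space UNIV"]
      by (simp add: nn_integral_count_space_nat)
    also have "\<dots> = (\<Sum>k. ennreal (1 - (\<mu> k)\<^sup>2) * (\<Sum>i. emeasure (return borel01 (\<mu> k)) (F i)))"
      by (simp add: ennreal_suminf_cmult)
    also have "\<dots> = (\<Sum>k. ennreal (1 - (\<mu> k)\<^sup>2) * emeasure (return borel01 (\<mu> k)) (\<Union>i. F i))"
      using F by (subst suminf_emeasure) auto
    finally show "(\<Sum>i k. ennreal (1 - (\<mu> k)\<^sup>2) * emeasure (return borel01 (\<mu> k)) (F i))
        = (\<Sum>k. ennreal (1 - (\<mu> k)\<^sup>2) * emeasure (return borel01 (\<mu> k)) (\<Union>i. F i))" .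
  qed
qed

end

theory Submission
  imports Defs
begin

text \<open>
  Testing the frame inequalities on the indicator functions of the atoms of \<open>\<nu>\<close> gives
  (2). For (1), \<open>(1 - x) x\<^sup>\<lambda> \<le> 1 / \<lambda>\<close> on \<open>(0, 1)\<close>; hence if \<open>\<Sum> 1 / \<lambda>\<^sub>n\<close> converged, dominated
  convergence along \<open>\<mu>\<^sub>k \<rightarrow> 1\<close> would force the quantity in (2) to tend to 0, against its lower bound.
\<close>

text \<open>A repeated point contributes a zero factor to the product based at that point. The
  product is then 0, below every admissible \<open>\<delta>\<close>.\<close>

lemma interpolating_imp_inj:
  assumes "interpolating z"
  shows "inj z"
proof (rule injI, rule ccontr)
  fix k j assume eq: "z k = z j" and "k \<noteq> j"
  define b where "b = (\<lambda>j. if j = k then 1 else norm ((z k - z j) / (1 - cnj (z j) * z k)))"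
  obtain d where "d > 0" and conv: "convergent_prod b" and "d \<le> prodinf b"
    using assms unfolding interpolating_def b_def Let_def by blast
  moreover have "b j = 0"
    using eq \<open>k \<noteq> j\<close> by (simp add: b_def)
  then have "prodinf b = 0"
    using has_prod_eq_0_iff[OF convergent_prod_has_prod[OF conv]] by (metis rangeI)
  ultimately show False
    by simp
qed

text \<open>The factors of the convergent product based at the point with index 0 tend to 1. For
  fixed \<open>\<mu> 0\<close>, a pseudohyperbolic distance tending to 1 forces
  \<open>\<mu> j\<close> to the unit circle, and for points of (0, 1) this means to 1.\<close>

lemma interpolating_real_tendsto_1:
  assumes "\<And>k. 0 < \<mu> k \<and> \<mu> k < 1"
    and "interpolating (\<lambda>k. complex_of_real (\<mu> k))"
  shows "\<mu> \<longlonglongrightarrow> 1"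
proof -
  define b where "b = (\<lambda>j. if j = 0 then 1 else norm ((complex_of_real (\<mu> 0) - \<mu> j) / (1 - cnj (\<mu> j) * \<mu> 0)))"
  have "convergent_prod b"
    using assms(2) unfolding interpolating_def b_def Let_def by blast
  then have "b \<longlonglongrightarrow> 1"
    by (rule convergent_prod_imp_LIMSEQ)
  moreover have x2: "1 - (\<mu> 0)\<^sup>2 > 0"
    using assms(1)[of 0] by (simp add: power_less_one_iff)
  ultimately have lim: "(\<lambda>j. (1 - (b j)\<^sup>2) / (1 - (\<mu> 0)\<^sup>2)) \<longlonglongrightarrow> (1 - 1\<^sup>2) / (1 - (\<mu> 0)\<^sup>2)"
    using x2 by (intro tendsto_intros) auto
  \<comment> \<open>Index 0 must be excluded: there \<open>b\<close> has the conventional value 1,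
    so the right-hand side is 0 while \<open>1 - \<mu> 0\<close> is positive.\<close>
  have bound: "1 - \<mu> j \<le> (1 - (b j)\<^sup>2) / (1 - (\<mu> 0)\<^sup>2)" if "j > 0" for j
  proof -
    let ?x = "\<mu> 0" and ?y = "\<mu> j"
    have x: "0 < ?x" "?x < 1" and y: "0 < ?y" "?y < 1"
      using assms(1) by auto
    have xy: "0 < ?x * ?y" "?x * ?y < 1"
      using x y mult_strict_mono[of ?x 1 ?y 1] by simp_all
    \<comment> \<open>This gives \<open>1 - ?y\<close> \<le> \<open>1 - ?y\<^sup>2\<close>, which
      turns the final estimate into one on \<open>1 - ?y\<close> itself.\<close>
    have y2: "?y\<^sup>2 \<le> ?y"
      using y by (simp add: power2_eq_square)
    have "b j = norm (complex_of_real ((?x - ?y) / (1 - ?y * ?x)))"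
      using that by (simp add: b_def)
    then have "(b j)\<^sup>2 = ((?x - ?y) / (1 - ?y * ?x))\<^sup>2"
      by (simp only: norm_of_real power2_abs)
    also have "\<dots> = (?x - ?y)\<^sup>2 / (1 - ?x * ?y)\<^sup>2"
      by (simp only: power_divide mult.commute)
    finally have "(b j)\<^sup>2 = (?x - ?y)\<^sup>2 / (1 - ?x * ?y)\<^sup>2" .
    then have "1 - (b j)\<^sup>2 = ((1 - ?x * ?y)\<^sup>2 - (?x - ?y)\<^sup>2) / (1 - ?x * ?y)\<^sup>2"
      using xy by (simp add: diff_divide_distrib)
    \<comment> \<open>The numerator factors: this is the standard identity for 1 minus the squared
      pseudohyperbolic distance, on real points.\<close>
    also have "(1 - ?x * ?y)\<^sup>2 - (?x - ?y)\<^sup>2 = (1 - ?x\<^sup>2) * (1 - ?y\<^sup>2)"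
      by algebra
    finally have "1 - (b j)\<^sup>2 = (1 - ?x\<^sup>2) * (1 - ?y\<^sup>2) / (1 - ?x * ?y)\<^sup>2" .
    \<comment> \<open>The denominator is at most 1, so dropping it only decreases the right-hand
      side; dividing by \<open>1 - (\<mu> 0)\<^sup>2\<close> then isolates the factor in
      \<open>?y\<close>.\<close>
    moreover have "(1 - ?x * ?y)\<^sup>2 \<le> 1"
      using xy by (simp add: power_le_one)
    then have "1 - ?y\<^sup>2 \<le> (1 - ?y\<^sup>2) / (1 - ?x * ?y)\<^sup>2"
      using xy y2 y divide_left_mono[of "(1 - ?x * ?y)\<^sup>2" 1 "1 - ?y\<^sup>2"] by simp
    ultimately show ?thesis
      using y2 x2 by simp
  qed
  have "(\<lambda>j. 1 - \<mu> j) \<longlonglongrightarrow> 0"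
  proof (rule tendsto_sandwich[OF _ _ tendsto_const])
    show "\<forall>\<^sub>F j in sequentially. 0 \<le> 1 - \<mu> j"
      using assms(1) by (simp add: less_imp_le)
    show "(\<lambda>j. (1 - (b j)\<^sup>2) / (1 - (\<mu> 0)\<^sup>2)) \<longlonglongrightarrow> 0"
      using lim by simp
    show "\<forall>\<^sub>F j in sequentially. 1 - \<mu> j \<le> (1 - (b j)\<^sup>2) / (1 - (\<mu> 0)\<^sup>2)"
      using eventually_gt_at_top[of 0] by eventually_elim (rule bound)
  qed
  from tendsto_diff[OF tendsto_const[of 1] this] show ?thesis
    by simp
qed

text \<open>Injectivity prevents several Dirac masses from piling up at one point, so a single term
  of the series survives.\<close>

lemma emeasure_point_mass_measure_atom:
  assumes "inj \<mu>" and "\<And>k. \<mu> k \<in> {0..<1}"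
  shows "emeasure (point_mass_measure \<mu>) {\<mu> k} = ennreal (1 - (\<mu> k)\<^sup>2)"
proof -
  have S: "{\<mu> k} \<in> sets borel01"
    using assms(2) by (auto simp: sets_restrict_space_iff)
  have "emeasure (point_mass_measure \<mu>) {\<mu> k} =
      (\<Sum>j. ennreal (1 - (\<mu> j)\<^sup>2) * emeasure (return borel01 (\<mu> j)) {\<mu> k})"
    by (rule emeasure_point_mass_measure[OF S])
  also have "\<dots> = (\<Sum>j. if j = k then ennreal (1 - (\<mu> k)\<^sup>2) else 0)"
    using S assms(1) by (intro suminf_cong) (auto simp: inj_eq indicator_def)
  also have "\<dots> = ennreal (1 - (\<mu> k)\<^sup>2)"
    by (subst suminf_finite[where N = "{k}"]) auto
  finally show ?thesis .
qed

text \<open>The test function is the indicator of {a}: its squared norm is m and its inner product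
  with \<open>x n\<close> is m times the conjugate of \<open>x n a\<close>. The frame inequalities
  become A m \<le> m^2 S \<le> B m, where S is the sum of the squared values at a. The constants are
  quantified before a and m, hence uniform over all atoms.\<close>

lemma L2_frame_atom:
  assumes "L2_frame M x"
  shows "\<exists>A>0. \<exists>B>0. \<forall>a m. {a} \<in> sets M \<longrightarrow> emeasure M {a} = ennreal m \<longrightarrow> m > 0 \<longrightarrow>
        ennreal A \<le> ennreal m * (\<Sum>n. ennreal ((norm (x n a))\<^sup>2)) \<and>
        ennreal m * (\<Sum>n. ennreal ((norm (x n a))\<^sup>2)) \<le> ennreal B"
proof -
  obtain A B where AB: "A > 0" "B > 0" and frame: "\<And>f. f \<in> L2_space M \<Longrightarrow>
        ennreal (A * (L2_norm M f)\<^sup>2) \<le> (\<Sum>n. ennreal ((norm (L2_inner M f (x n)))\<^sup>2)) \<and>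
        (\<Sum>n. ennreal ((norm (L2_inner M f (x n)))\<^sup>2)) \<le> ennreal (B * (L2_norm M f)\<^sup>2)"
    using assms unfolding L2_frame_def by blast
  have "ennreal A \<le> ennreal m * (\<Sum>n. ennreal ((norm (x n a))\<^sup>2)) \<and>
        ennreal m * (\<Sum>n. ennreal ((norm (x n a))\<^sup>2)) \<le> ennreal B"
    if S: "{a} \<in> sets M" and em: "emeasure M {a} = ennreal m" and m: "m > 0" for a m
  proof -
    let ?f = "indicator {a} :: 'a \<Rightarrow> complex"
    have meas: "measure M {a} = m"
      using em m by (simp add: measure_def)
    have fin: "emeasure M {a} < \<infinity>"
      by (simp add: em)
    have sp: "space M \<inter> {a} = {a}"
      using sets.sets_into_space[OF S] by auto
    have sq: "(norm (?f t))\<^sup>2 = indicat_real {a} t" for t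
      by (simp add: indicator_def)
    have f: "?f \<in> L2_space M"
      using S fin by (simp add: L2_space_def sq integrable_real_indicator)
    have nrm: "(L2_norm M ?f)\<^sup>2 = m"
      unfolding L2_norm_def sq using m by (simp add: sp Int_commute meas)
    have inner: "L2_inner M ?f (x n) = m *\<^sub>R cnj (x n a)" for n
    proof -
      have "?f t * cnj (x n t) = indicat_real {a} t *\<^sub>R cnj (x n a)" for t
        by (simp add: indicator_def)
      then show ?thesis
        unfolding L2_inner_def using S fin
        by (simp add: sp Int_commute meas)
    qed
    have sum: "(\<Sum>n. ennreal ((norm (L2_inner M ?f (x n)))\<^sup>2)) =
        ennreal m * (ennreal m * (\<Sum>n. ennreal ((norm (x n a))\<^sup>2)))"
    proof -
      have "ennreal ((norm (L2_inner M ?f (x n)))\<^sup>2) = ennreal m * ennreal m * ennreal ((norm (x n a))\<^sup>2)" for n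
        using m unfolding inner
        by (simp add: power_mult_distrib power2_eq_square[of m] ennreal_mult)
      then show ?thesis
        by (simp add: ennreal_suminf_cmult mult.assoc)
    qed
    \<comment> \<open>Both inequalities carry a common factor \<open>ennreal m\<close>. It is
      neither 0 nor infinite, so it cancels in \<open>ennreal\<close> without knowing beforehand
      that the series is finite.\<close>
    have "ennreal m * ennreal A \<le> ennreal m * (ennreal m * (\<Sum>n. ennreal ((norm (x n a))\<^sup>2)))"
      and "ennreal m * (ennreal m * (\<Sum>n. ennreal ((norm (x n a))\<^sup>2))) \<le> ennreal m * ennreal B"
      using frame[OF f] m AB unfolding nrm sum by (simp_all add: ennreal_mult' mult.commute)
    then show ?thesis
      using m by (simp add: ennreal_mult_le_mult_iff)
  qed
  with AB show ?thesis
    by (intro exI[of _ A] exI[of _ B] conjI) simp_all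
qed

text \<open>With y = -l ln x, the estimate 1 - x \<le> -ln x bounds l times the left-hand side by y
  exp(-y), and y \<le> exp y makes this at most 1.\<close>

lemma one_minus_times_powr_le:
  assumes "0 < x" "x < 1" and "0 < (l::real)"
  shows "(1 - x) * x powr l \<le> 1 / l"
proof -
  define y where "y = - ln x * l"
  have "1 - x \<le> - ln x"
    using ln_le_minus_one[of x] assms by simp
  then have "(1 - x) * x powr l * l \<le> - ln x * x powr l * l"
    using assms by (intro mult_right_mono) auto
  also have "\<dots> = y * exp (- y)"
    using assms by (simp add: y_def powr_def mult_ac)
  also have "\<dots> \<le> exp y * exp (- y)"
    using exp_ge_add_one_self[of y] by (intro mult_right_mono) (linarith, simp)
  finally show ?thesis
    using assms by (simp add: exp_minus field_simps)
qed

text \<open>Dominated convergence, with the series read as an integral against counting measure. The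
  majorant \<open>1 / lam n\<close> is independent of k, and each single term tends to 0 because of
  the weight \<open>1 - x k\<close>.\<close>

lemma tendsto_weighted_powr_suminf:
  assumes "\<And>k. 0 < x k \<and> x k < 1" and "x \<longlonglongrightarrow> 1"
    and "\<And>n. 0 < lam n" and "(\<Sum>n. ennreal (1 / lam n)) \<noteq> \<infinity>"
  shows "(\<lambda>k. ennreal (1 - x k) * (\<Sum>n. ennreal (x k powr lam n))) \<longlonglongrightarrow> 0"
proof -
  let ?g = "\<lambda>k n. ennreal ((1 - x k) * x k powr lam n)"
  have "(\<lambda>k. \<integral>\<^sup>+n. ?g k n \<partial>count_space UNIV) \<longlonglongrightarrow> (\<integral>\<^sup>+(n::nat). 0 \<partial>count_space UNIV)"
  proof (rule nn_integral_dominated_convergence[where w = "\<lambda>n. ennreal (1 / lam n)"])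
    show "(\<integral>\<^sup>+n. ennreal (1 / lam n) \<partial>count_space UNIV) < \<infinity>"
      using assms(4) by (simp add: nn_integral_count_space_nat top.not_eq_extremum)
    show "AE n in count_space UNIV. ?g k n \<le> ennreal (1 / lam n)" for k
      using assms(1,3) by (intro AE_I2 ennreal_leI one_minus_times_powr_le) auto
    show "AE n in count_space UNIV. (\<lambda>k. ?g k n) \<longlonglongrightarrow> 0"
    proof (rule AE_I2)
      fix n
      have "(\<lambda>k. (1 - x k) * x k powr lam n) \<longlonglongrightarrow> (1 - 1) * 1 powr lam n"
        by (intro tendsto_intros assms(2)) auto
      then show "(\<lambda>k. ?g k n) \<longlonglongrightarrow> 0"
        by (metis diff_self ennreal_0 mult_zero_left tendsto_ennrealI)
    qed
  qed auto
  moreover have "(\<integral>\<^sup>+n. ?g k n \<partial>count_space UNIV) = ennreal (1 - x k) * (\<Sum>n. ennreal (x k powr lam n))" for k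
    using assms(1)[of k] by (simp add: nn_integral_count_space_nat ennreal_mult' ennreal_suminf_cmult)
  ultimately show ?thesis
    by simp
qed

theorem proposition3p5:
  fixes \<mu> lam :: "nat \<Rightarrow> real" and \<nu> :: "real measure"
  assumes "\<And>k. 0 < \<mu> k \<and> \<mu> k < 1"
    and "interpolating (\<lambda>k. complex_of_real (\<mu> k))"
    and "\<nu> = point_mass_measure \<mu>"
    and "L2_frame \<nu> (\<lambda>l t. complex_of_real (t ^ l))"
    and "\<And>n. 0 < lam n"
    and "L2_frame \<nu> (\<lambda>n t. complex_of_real (t powr lam n))"
  shows "(\<Sum>n. ennreal (1 / lam n)) = \<infinity> \<and>
    0 < (INF k. ennreal (1 - (\<mu> k)\<^sup>2) * (\<Sum>n. ennreal (\<mu> k powr (2 * lam n)))) \<and>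
    (INF k. ennreal (1 - (\<mu> k)\<^sup>2) * (\<Sum>n. ennreal (\<mu> k powr (2 * lam n))))
      \<le> (SUP k. ennreal (1 - (\<mu> k)\<^sup>2) * (\<Sum>n. ennreal (\<mu> k powr (2 * lam n)))) \<and>
    (SUP k. ennreal (1 - (\<mu> k)\<^sup>2) * (\<Sum>n. ennreal (\<mu> k powr (2 * lam n)))) < \<infinity>"
proof -
  define Q where "Q = (\<lambda>k. ennreal (1 - (\<mu> k)\<^sup>2) * (\<Sum>n. ennreal (\<mu> k powr (2 * lam n))))"
  have sq01: "0 < (\<mu> k)\<^sup>2 \<and> (\<mu> k)\<^sup>2 < 1" for k
    using assms(1)[of k] by (simp add: power_less_one_iff)
  \<comment> \<open>The first form rewrites the squared values in the frame sums; the second serves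
    the substitution of \<open>(\<mu> k)\<^sup>2\<close> for the base.\<close>
  have powr_sq: "(\<mu> k powr l)\<^sup>2 = \<mu> k powr (2 * l)" "(\<mu> k)\<^sup>2 powr l = \<mu> k powr (2 * l)" for k l
    using assms(1)[of k] by (simp_all add: powr_powr mult.commute flip: powr_numeral)
  have "inj \<mu>"
    using interpolating_imp_inj[OF assms(2)] by (auto simp: inj_def)
  moreover have in01: "\<mu> k \<in> {0..<1}" for k
    using assms(1)[of k] by simp
  ultimately have atom: "emeasure \<nu> {\<mu> k} = ennreal (1 - (\<mu> k)\<^sup>2)" for k
    unfolding assms(3) by (rule emeasure_point_mass_measure_atom)
  obtain A B where "A > 0" "B > 0"
    and AB: "\<forall>a m. {a} \<in> sets \<nu> \<longrightarrow> emeasure \<nu> {a} = ennreal m \<longrightarrow> m > 0 \<longrightarrow>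
        ennreal A \<le> ennreal m * (\<Sum>n. ennreal ((norm (complex_of_real (a powr lam n)))\<^sup>2)) \<and>
        ennreal m * (\<Sum>n. ennreal ((norm (complex_of_real (a powr lam n)))\<^sup>2)) \<le> ennreal B"
    using L2_frame_atom[OF assms(6)] by (elim exE conjE) (rule that)
  have "(norm (complex_of_real (\<mu> k powr l)))\<^sup>2 = \<mu> k powr (2 * l)" for k l
    by (simp only: norm_of_real power2_abs powr_sq)
  moreover have "{\<mu> k} \<in> sets \<nu>" for k
    using in01[of k] by (simp add: assms(3) sets_restrict_space_iff)
  moreover have "1 - (\<mu> k)\<^sup>2 > 0" for k
    using sq01[of k] by simp
  ultimately have Q: "ennreal A \<le> Q k" "Q k \<le> ennreal B" for k
    using AB[rule_format, OF _ atom[of k]] by (simp_all only: Q_def)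
  have "(\<Sum>n. ennreal (1 / lam n)) = \<infinity>"
  proof (rule ccontr)
    assume fin: "(\<Sum>n. ennreal (1 / lam n)) \<noteq> \<infinity>"
    \<comment> \<open>The limit lemma is applied to the squares \<open>(\<mu> k)\<^sup>2\<close>:
      both the weight \<open>1 - (\<mu> k)\<^sup>2\<close> and the exponents
      \<open>2 * lam n\<close> then match \<open>Q\<close> exactly.\<close>
    have "(\<lambda>k. (\<mu> k)\<^sup>2) \<longlonglongrightarrow> 1"
      using tendsto_power[OF interpolating_real_tendsto_1[OF assms(1,2)], of 2] by simp
    from tendsto_weighted_powr_suminf[OF sq01 this assms(5) fin]
    have "Q \<longlonglongrightarrow> 0"
      by (simp add: Q_def powr_sq)
    then have "ennreal A \<le> 0"
      using Q(1) by (intro LIMSEQ_le_const) auto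
    with \<open>A > 0\<close> show False
      by simp
  qed
  \<comment> \<open>Since A and B do not depend on k, the bounds on \<open>Q k\<close> pass to the
    infimum and the supremum.\<close>
  moreover have "ennreal A \<le> (INF k. Q k)"
    by (intro INF_greatest Q)
  then have "0 < (INF k. Q k)"
    using \<open>A > 0\<close> by (meson ennreal_less_zero_iff less_le_trans)
  moreover have "(INF k. Q k) \<le> (SUP k. Q k)"
    by (intro INF_le_SUP) simp
  moreover have "(SUP k. Q k) \<le> ennreal B"
    by (intro SUP_least Q)
  then have "(SUP k. Q k) < \<infinity>"
    by (simp add: le_less_trans)
  ultimately show ?thesis
    unfolding Q_def by (intro conjI)
qed

end
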